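(* Let $n\ge 1$ be an odd integer. Then the infinite product $$P_{n}=\prod_{k=0}^{\infty}\left[\prod_{j=0}^{n}\frac{(4k+4j+3)^{T(n,j)}}{(4k+4(n-j)+1)^{T(n,j)}}\right]^{\binom{n+k}{n}}$$ converges absolutely and $$e^{\beta'(-n)}=P_{n}.$$
   Context: Dirichlet beta function: $\beta(s)=\sum_{m=0}^{\infty}(-1)^m(2m+1)^{-s}$ for $\Re s>0$, extended to an entire function of $s$ by analytic continuation; equivalently $\beta(s)=4^{-s}\big(\zeta(s,1/4)-\zeta(s,3/4)\big)$ with $\zeta(s,a)$ the Hurwitz zeta function. $\beta'$ is its derivative. Generalised Eulerian weights: integers $T(n,k)$ with $T(0,0)=1$, $T(n,k)=0$ for $k<0$ or $k>n$, and for $n\ge 0$, $0\le k\le n+1$, $$T(n+1,k)=\big(4(n-k)+5\big)T(n,k-1)+(4k+3)T(n,k).$$ The product is taken over $k$ of the bracketed blocks raised to the power $\binom{n+k}{n}$ (each such power being one factor); absolute convergence means that the series of logarithms of these (positive) factors converges absolutely. *)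

theory Defs
  imports "HOL-Complex_Analysis.Complex_Analysis"
begin

text \<open>
  The Dirichlet beta function, as the entire function extending
  $\sum_m (-1)^m (2m+1)^{-s}$ from the half plane $\Re s > 0$.  Such an extension exists,
  and it is unique by the identity theorem, so the definite description is meaningful.
  The series converges only conditionally for $0 < \Re s \le 1$, hence \<open>sums\<close>.
\<close>

definition dirichlet_beta :: "complex \<Rightarrow> complex" where
  "dirichlet_beta = (THE f. f holomorphic_on UNIV \<and>
     (\<forall>s. Re s > 0 \<longrightarrow>
        (\<lambda>m. (-1) ^ m * of_nat (2 * m + 1) powr (- s)) sums f s))"

text \<open>
  The second index is an integer, so that the term \<open>T (n, k - 1)\<close> of the recurrence
  is literally the (vanishing) out-of-range weight when \<open>k = 0\<close>.
\<close>

fun gen_eulerian :: "nat \<Rightarrow> int \<Rightarrow> int" where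
  "gen_eulerian 0 k = (if k = 0 then 1 else 0)"
| "gen_eulerian (Suc n) k =
     (if 0 \<le> k \<and> k \<le> int n + 1
      then (4 * (int n - k) + 5) * gen_eulerian n (k - 1) + (4 * k + 3) * gen_eulerian n k
      else 0)"

definition beta_prod_factor :: "nat \<Rightarrow> nat \<Rightarrow> real" where
  "beta_prod_factor n k =
     (\<Prod>j=0..n. real (4 * k + 4 * j + 3) powi gen_eulerian n (int j)
               / real (4 * k + 4 * (n - j) + 1) powi gen_eulerian n (int j))
       ^ ((n + k) choose n)"

end

theory Submission
  imports Defs
begin

text \<open>
  Write \<open>T(n, j)\<close> for the weights.  Formally,
  \<open>\<beta>'(-n) = \<Sum>m. (4m + 3)^n ln (4m + 3) - (4m + 1)^n ln (4m + 1)\<close>, a divergent series, and the product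
  is a resummation of it, read off from the Worpitzky-type identities
  \<open>\<Sum>j. T(n, j) C(m + n - j, n) = (4m + 3)^n\<close> and \<open>\<Sum>j. T(n, j) C(m + j, n) = (4m + 1)^n\<close>
  (\<open>sum_eulerian_weight_gchoose\<close> and its reflected form).  To make this rigorous, the logarithms
  are replaced by powers with a complex exponent:
  \<open>G(w) = \<Sum>k. C(n + k, n) * (\<Sum>j. T(n, j) * ((4k + 4(n - j) + 1)^(-w) - (4k + 4j + 3)^(-w)))\<close>.
  For \<open>Re w\<close> large everything converges absolutely, and collecting equal bases with the identities
  above gives \<open>G(w) = \<beta>(w - n)\<close> (\<open>beta_term_sums_imp\<close>).  Differentiating \<open>G\<close> term by term at
  \<open>w = 0\<close> gives exactly the series of logarithms of the factors of the product.  So it suffices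
  that the series for \<open>G\<close> converges locally uniformly on a neighbourhood of \<open>0\<close>; the
  identity theorem does the rest.

  The convergence is due to cancellation in the inner sum, the functional
  \<open>\<phi> \<mapsto> \<Sum>j. T(n, j) * (\<phi>(4(n - j) + 1) - \<phi>(4j + 3))\<close>.  The recurrence for \<open>T\<close> says that this
  functional for \<open>n + 1\<close> is the one for \<open>n\<close> composed with
  \<open>\<phi>(y) \<mapsto> y \<phi>(y) + (4n + 4 - y) \<phi>(y + 4)\<close>; that operator multiplies the leading coefficient of a
  polynomial of degree \<open>p\<close> by \<open>4(n + 1 - p)\<close>, hence lowers the degree when \<open>p = n + 1\<close>.  By
  induction the functional kills all polynomials of degree at most \<open>n\<close>.  It is also
  antisymmetric under \<open>y \<mapsto> 4n + 4 - y\<close>, so it kills the even power \<open>(y - (2n + 2))^(n + 1)\<close> when \<open>n\<close>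
  is odd.  By Taylor's formula the inner sum is then \<open>O(k^(-Re w - n - 2))\<close>, against a
  binomial coefficient of size \<open>k^n\<close>: this gives absolute convergence for \<open>Re w > -1\<close>.  This is the
  only place where the parity of \<open>n\<close> enters.

  For arbitrary \<open>n\<close> the same argument, one order weaker, gives convergence for \<open>Re w > 0\<close>, so that
  \<open>\<beta>(s)\<close> is represented on \<open>Re s > -n\<close>.  Gluing these representations over all \<open>n\<close>
  produces the entire function whose existence the definition of \<open>dirichlet_beta\<close> presupposes.
\<close>

section \<open>The difference functional of the Eulerian weights\<close>

abbreviation eulerian_weight :: "nat \<Rightarrow> nat \<Rightarrow> complex" where
  "eulerian_weight n j \<equiv> of_int (gen_eulerian n (int j))"

lemma gen_eulerian_out_of_range: "k < 0 \<or> int n < k \<Longrightarrow> gen_eulerian n k = 0"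
  by (induction n arbitrary: k) auto

text \<open>
  Summation by parts for the recurrence: the shift is moved from the weights onto the test
  function.  Both the cancellation and the Worpitzky identities are inductions over this formula.
\<close>

lemma sum_eulerian_weight_Suc:
  fixes g :: "nat \<Rightarrow> complex"
  shows "(\<Sum>j\<le>Suc n. eulerian_weight (Suc n) j * g j) =
    (\<Sum>j\<le>n. eulerian_weight n j * (of_nat (4 * (n - j) + 1) * g (Suc j) + of_nat (4 * j + 3) * g j))"
proof -
  define a where "a j = of_int (4 * (int n - int j) + 5) * of_int (gen_eulerian n (int j - 1)) * g j" for j
  define b where "b j = of_nat (4 * j + 3) * eulerian_weight n j * g j" for j
  have "(\<Sum>j\<le>Suc n. eulerian_weight (Suc n) j * g j) = (\<Sum>j\<le>Suc n. a j + b j)"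
    by (rule sum.cong) (auto simp: a_def b_def algebra_simps)
  also have "\<dots> = (\<Sum>j\<le>Suc n. a j) + (\<Sum>j\<le>Suc n. b j)"
    by (rule sum.distrib)
  also have "(\<Sum>j\<le>Suc n. a j) = (\<Sum>j\<le>n. a (Suc j))"
    by (subst sum.atMost_Suc_shift) (simp add: a_def gen_eulerian_out_of_range)
  also have "(\<Sum>j\<le>Suc n. b j) = (\<Sum>j\<le>n. b j)"
    by (simp add: b_def gen_eulerian_out_of_range)
  also have "(\<Sum>j\<le>n. a (Suc j)) + (\<Sum>j\<le>n. b j) = (\<Sum>j\<le>n. a (Suc j) + b j)"
    by (rule sum.distrib [symmetric])
  also have "\<dots> = (\<Sum>j\<le>n. eulerian_weight n j *
      (of_nat (4 * (n - j) + 1) * g (Suc j) + of_nat (4 * j + 3) * g j))"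
    by (rule sum.cong) (auto simp: a_def b_def algebra_simps of_nat_diff)
  finally show ?thesis .
qed

definition eulerian_difference :: "nat \<Rightarrow> (nat \<Rightarrow> complex) \<Rightarrow> complex" where
  "eulerian_difference n \<phi> =
     (\<Sum>j\<le>n. eulerian_weight n j * (\<phi> (4 * (n - j) + 1) - \<phi> (4 * j + 3)))"

lemma eulerian_difference_cong:
  assumes "\<And>y. y \<le> 4 * n + 3 \<Longrightarrow> y > 0 \<Longrightarrow> \<phi> y = \<psi> y"
  shows "eulerian_difference n \<phi> = eulerian_difference n \<psi>"
  unfolding eulerian_difference_def using assms by (intro sum.cong) auto

lemma eulerian_difference_diff:
  "eulerian_difference n (\<lambda>y. \<phi> y - \<psi> y) = eulerian_difference n \<phi> - eulerian_difference n \<psi>"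
  unfolding eulerian_difference_def by (simp add: sum_subtractf [symmetric] algebra_simps)

lemma eulerian_difference_cmult:
  "eulerian_difference n (\<lambda>y. c * \<phi> y) = c * eulerian_difference n \<phi>"
  unfolding eulerian_difference_def by (simp add: sum_distrib_left algebra_simps)

lemma eulerian_difference_sum:
  "eulerian_difference n (\<lambda>y. \<Sum>i\<in>I. \<phi> i y) = (\<Sum>i\<in>I. eulerian_difference n (\<phi> i))"
proof -
  have "eulerian_difference n (\<lambda>y. \<Sum>i\<in>I. \<phi> i y) =
      (\<Sum>j\<le>n. \<Sum>i\<in>I. eulerian_weight n j * (\<phi> i (4 * (n - j) + 1) - \<phi> i (4 * j + 3)))"
    unfolding eulerian_difference_def
    by (simp only: sum_subtractf [symmetric] sum_distrib_left)
  also have "\<dots> = (\<Sum>i\<in>I. \<Sum>j\<le>n. eulerian_weight n j * (\<phi> i (4 * (n - j) + 1) - \<phi> i (4 * j + 3)))"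
    by (rule sum.swap)
  finally show ?thesis
    unfolding eulerian_difference_def .
qed

text \<open>
  Both families of nodes obey the same rule: a node \<open>y\<close> of level \<open>n\<close> contributes to level
  \<open>n + 1\<close> at \<open>y\<close> with weight \<open>y\<close> and at \<open>y + 4\<close> with the weight \<open>4n + 4 - y\<close> of its mirror image.
\<close>

lemma eulerian_difference_Suc:
  "eulerian_difference (Suc n) \<phi> = eulerian_difference n
     (\<lambda>y. of_nat y * \<phi> y + of_nat (4 * n + 4 - y) * \<phi> (y + 4))"
proof -
  define g where "g j = \<phi> (4 * (Suc n - j) + 1) - \<phi> (4 * j + 3)" for j
  have "eulerian_difference (Suc n) \<phi> = (\<Sum>j\<le>Suc n. eulerian_weight (Suc n) j * g j)"
    unfolding eulerian_difference_def g_def ..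
  also note sum_eulerian_weight_Suc
  also have "(\<Sum>j\<le>n. eulerian_weight n j * (of_nat (4 * (n - j) + 1) * g (Suc j) + of_nat (4 * j + 3) * g j)) =
    eulerian_difference n (\<lambda>y. of_nat y * \<phi> y + of_nat (4 * n + 4 - y) * \<phi> (y + 4))"
    unfolding eulerian_difference_def
  proof (rule sum.cong [OF refl], goal_cases)
    case (1 j)
    define a where "a = 4 * (n - j) + 1"
    define b where "b = 4 * j + 3"
    have eq: "4 * n + 4 - a = b" "4 * n + 4 - b = a" "4 * (Suc n - j) + 1 = a + 4"
        "4 * Suc j + 3 = b + 4" "4 * (Suc n - Suc j) + 1 = a"
      using 1 by (auto simp: a_def b_def)
    show ?case
      unfolding g_def a_def [symmetric] b_def [symmetric] eq by (simp add: algebra_simps)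
  qed
  finally show ?thesis .
qed

text \<open>
  The operator of the preceding lemma sends \<open>y ^ p\<close> to a polynomial in which \<open>y ^ (p + 1)\<close>
  cancels and \<open>y ^ p\<close> has the coefficient \<open>4 (n + 1 - p)\<close>.  The coefficient vanishes for
  \<open>p = n + 1\<close>, which is what carries the induction one degree further.
\<close>

lemma eulerian_difference_power_eq_0:
  "p \<le> n \<Longrightarrow> eulerian_difference n (\<lambda>y. of_nat y ^ p) = 0"
proof (induction n arbitrary: p)
  case 0
  then show ?case by (simp add: eulerian_difference_def)
next
  case (Suc n)
  define D where "D = eulerian_difference n"
  define c where "c i = (of_nat (p choose i) * 4 ^ (p - i) :: complex)" for i :: nat
  have expand: "of_nat (y + 4) ^ p = (\<Sum>i\<le>p. c i * of_nat y ^ i)" for y :: nat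
    by (simp add: binomial_ring c_def mult_ac)
  have zero: "D (\<lambda>y. of_nat y ^ i) = 0" if "i \<le> n" for i
    unfolding D_def using that by (rule Suc.IH)
  have "eulerian_difference (Suc n) (\<lambda>y. of_nat y ^ p) =
      D (\<lambda>y. of_nat y * of_nat y ^ p + of_nat (4 * n + 4 - y) * of_nat (y + 4) ^ p)"
    unfolding D_def by (rule eulerian_difference_Suc)
  also have "\<dots> = D (\<lambda>y. of_nat y ^ Suc p + of_nat (4 * n + 4) * of_nat (y + 4) ^ p - of_nat y * of_nat (y + 4) ^ p)"
    unfolding D_def by (rule eulerian_difference_cong) (simp add: algebra_simps of_nat_diff)
  also have "(\<lambda>y. of_nat y ^ Suc p + of_nat (4 * n + 4) * of_nat (y + 4) ^ p - of_nat y * of_nat (y + 4) ^ p) =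
     (\<lambda>y. (\<Sum>i\<le>p. (of_nat (4 * n + 4) * c i) * of_nat y ^ i) - (\<Sum>i<p. c i * of_nat y ^ Suc i))"
    by (rule ext) (simp only: expand, simp add: lessThan_Suc_atMost [symmetric] sum_distrib_left algebra_simps c_def)
  also have "D \<dots> = (\<Sum>i\<le>p. (of_nat (4 * n + 4) * c i) * D (\<lambda>y. of_nat y ^ i)) - (\<Sum>i<p. c i * D (\<lambda>y. of_nat y ^ Suc i))"
    unfolding D_def by (simp only: eulerian_difference_diff eulerian_difference_sum eulerian_difference_cmult)
  also have "\<dots> = 0"
  proof (cases "p \<le> n")
    case True
    then show ?thesis by (simp add: zero del: power_Suc)
  next
    case False
    then have "p = Suc n" using Suc.prems by simp
    then show ?thesis
      by (simp add: zero lessThan_Suc_atMost [symmetric] c_def algebra_simps del: power_Suc)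
  qed
  finally show ?case .
qed

lemma eulerian_difference_reflect:
  "eulerian_difference n (\<lambda>y. \<phi> (4 * n + 4 - y)) = - eulerian_difference n \<phi>"
  unfolding eulerian_difference_def sum_negf [symmetric]
proof (rule sum.cong [OF refl], goal_cases)
  case (1 j)
  then have "4 * n + 4 - (4 * (n - j) + 1) = 4 * j + 3" "4 * n + 4 - (4 * j + 3) = 4 * (n - j) + 1"
    by auto
  then show ?case
    by (simp only:) (simp add: algebra_simps)
qed

text \<open>
  Modulo lower powers \<open>y ^ (n + 1)\<close> may be centred at the fixed point of the reflection, where
  its even exponent makes it symmetric, while the functional is antisymmetric.
\<close>

lemma eulerian_difference_power_Suc_eq_0:
  assumes "odd n"
  shows "eulerian_difference n (\<lambda>y. of_nat y ^ (n + 1)) = 0"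
proof -
  define D where "D = eulerian_difference n"
  \<comment> \<open>The centre of the reflection \<open>y \<mapsto> 4 * n + 4 - y\<close>.\<close>
  define m where "m = of_nat (4 * n + 4) / (2 :: complex)"
  define c where "c i = of_nat (Suc n choose i) * (- m) ^ (Suc n - i)" for i :: nat
  define \<phi> where "\<phi> = (\<lambda>y. (of_nat y - m) ^ (n + 1))"
  have expand: "\<phi> y = (\<Sum>i\<le>Suc n. c i * of_nat y ^ i)" for y :: nat
    using binomial_ring [of "of_nat y" "- m" "Suc n"] by (simp add: \<phi>_def c_def mult_ac del: power_Suc)
  have "D \<phi> = (\<Sum>i\<le>Suc n. c i * D (\<lambda>y. of_nat y ^ i))"
    unfolding D_def expand [abs_def] eulerian_difference_sum eulerian_difference_cmult ..
  also have "\<dots> = D (\<lambda>y. of_nat y ^ (n + 1))"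
    by (simp add: D_def eulerian_difference_power_eq_0 c_def)
  finally have *: "D (\<lambda>y. of_nat y ^ (n + 1)) = D \<phi>" ..
  have "D \<phi> = D (\<lambda>y. \<phi> (4 * n + 4 - y))"
    unfolding D_def
  proof (rule eulerian_difference_cong)
    fix y assume "y \<le> 4 * n + 3"
    then have "of_nat (4 * n + 4 - y) - m = - (of_nat y - m)"
      by (simp add: m_def of_nat_diff field_simps)
    then show "\<phi> y = \<phi> (4 * n + 4 - y)"
      using assms unfolding \<phi>_def by (metis even_plus_one_iff power_minus_even)
  qed
  also have "\<dots> = - D \<phi>"
    unfolding D_def by (rule eulerian_difference_reflect)
  finally show ?thesis
    using * by (simp add: D_def)
qed

section \<open>Worpitzky identities\<close>

text \<open>
  By Pascal's rule and absorption, the two contributions of each \<open>j\<close> to level \<open>n + 1\<close> combine to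
  \<open>4 * x + 3\<close> times its contribution to level \<open>n\<close>.
  Stated for a complex argument rather than an integer one, so that the argument can be
  reflected in the next lemma.
\<close>

lemma sum_eulerian_weight_gchoose:
  fixes x :: complex
  shows "(\<Sum>j\<le>n. eulerian_weight n j * ((x + of_nat (n - j)) gchoose n)) = (4 * x + 3) ^ n"
proof (induction n)
  case 0
  then show ?case by simp
next
  case (Suc n)
  have "(\<Sum>j\<le>Suc n. eulerian_weight (Suc n) j * ((x + of_nat (Suc n - j)) gchoose Suc n)) =
     (\<Sum>j\<le>n. eulerian_weight n j * (of_nat (4 * (n - j) + 1) * ((x + of_nat (Suc n - Suc j)) gchoose Suc n)
        + of_nat (4 * j + 3) * ((x + of_nat (Suc n - j)) gchoose Suc n)))"
    by (rule sum_eulerian_weight_Suc)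
  also have "\<dots> = (\<Sum>j\<le>n. (4 * x + 3) * (eulerian_weight n j * ((x + of_nat (n - j)) gchoose n)))"
  proof (rule sum.cong [OF refl], goal_cases)
    case (1 j)
    define y where "y = x + of_nat (n - j)"
    have x: "x + of_nat (Suc n - Suc j) = y" "x + of_nat (Suc n - j) = y + 1"
      using 1 by (auto simp: y_def Suc_diff_le)
    have absorb: "of_nat (Suc n) * (y gchoose Suc n) = (y - of_nat n) * (y gchoose n)"
      using gbinomial_absorption [of n y] gbinomial_absorb_comp [of y n] by simp
    have y': "4 * x + 3 = 4 * (y - of_nat n) + of_nat (4 * j + 3)"
      using 1 by (simp add: y_def of_nat_diff)
    have sum: "of_nat (4 * (n - j) + 1) + of_nat (4 * j + 3) = (4 * of_nat (Suc n) :: complex)"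
      using 1 by (simp add: of_nat_diff)
    have "of_nat (4 * (n - j) + 1) * (y gchoose Suc n) + of_nat (4 * j + 3) * ((y + 1) gchoose Suc n) =
       (of_nat (4 * (n - j) + 1) + of_nat (4 * j + 3)) * (y gchoose Suc n) + of_nat (4 * j + 3) * (y gchoose n)"
      unfolding gbinomial_Suc_Suc by algebra
    also have "\<dots> = 4 * ((y - of_nat n) * (y gchoose n)) + of_nat (4 * j + 3) * (y gchoose n)"
      unfolding sum absorb [symmetric] by (simp add: algebra_simps)
    also have "\<dots> = (4 * x + 3) * (y gchoose n)"
      unfolding y' by algebra
    finally show ?case
      unfolding x y_def [symmetric] by (simp add: mult_ac)
  qed
  also have "\<dots> = (4 * x + 3) ^ Suc n"
    by (simp only: sum_distrib_left [symmetric] Suc.IH power_Suc)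
  finally show ?case .
qed

text \<open>
  Substituting \<open>- 1 - x\<close> for \<open>x\<close> and negating the upper index of the binomial coefficients
  turns \<open>4 * x + 3\<close> into \<open>- (4 * x + 1)\<close>.
\<close>

lemma sum_eulerian_weight_gchoose_reflected:
  fixes x :: complex
  shows "(\<Sum>j\<le>n. eulerian_weight n j * ((x + of_nat j) gchoose n)) = (4 * x + 1) ^ n"
proof -
  have "(\<Sum>j\<le>n. eulerian_weight n j * ((x + of_nat j) gchoose n)) =
      (-1) ^ n * (\<Sum>j\<le>n. eulerian_weight n j * (((- 1 - x) + of_nat (n - j)) gchoose n))"
    unfolding sum_distrib_left
  proof (rule sum.cong [OF refl], goal_cases)
    case (1 j)
    then have "of_nat n - (x + of_nat j) - 1 = - 1 - x + of_nat (n - j)"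
      by (simp add: of_nat_diff algebra_simps)
    then have "((x + of_nat j) gchoose n) = (-1) ^ n * ((- 1 - x + of_nat (n - j)) gchoose n)"
      using gbinomial_negated_upper [of "x + of_nat j" n] by (simp only:)
    then show ?case
      by (simp only: mult_ac)
  qed
  also have "\<dots> = (-1) ^ n * (4 * (- 1 - x) + 3) ^ n"
    unfolding sum_eulerian_weight_gchoose ..
  also have "\<dots> = (4 * x + 1) ^ n"
    by (simp add: power_mult_distrib [symmetric] algebra_simps)
  finally show ?thesis .
qed

section \<open>Convergence of the accelerated series\<close>

text \<open>
  Taylor expansion of \<open>z powr (- w)\<close> at \<open>x\<close>: the functional kills the Taylor polynomial of degree
  \<open>N - 1\<close>, and the remainder is governed by the \<open>N\<close>-th derivative, which is largest at the left
  end of the interval \<open>[x, x + 4n + 3]\<close>.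
\<close>

lemma eulerian_difference_powr_bound:
  assumes N: "N > 0" and vanish: "\<And>p. p < N \<Longrightarrow> eulerian_difference n (\<lambda>y. of_nat y ^ p) = 0"
  obtains C where "C \<ge> 0"
    "\<And>x w. x > 0 \<Longrightarrow> Re w + real N \<ge> 0 \<Longrightarrow>
       norm (eulerian_difference n (\<lambda>y. of_nat (x + y) powr (- w)))
         \<le> C * norm (pochhammer w N) * real x powr (- (Re w + real N))"
proof -
  define C where "C = (\<Sum>j\<le>n. norm (eulerian_weight n j)) * (2 * real (4 * n + 4) ^ N)"
  show ?thesis
  proof
    show "C \<ge> 0"
      by (simp add: C_def sum_nonneg)
  next
    fix x :: nat and w :: complex
    assume x: "x > 0" and w: "Re w + real N \<ge> 0"
    obtain M where M: "N = Suc M"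
      using N gr0_implies_Suc by blast
    \<comment> \<open>The derivatives of \<open>\<lambda>z. z powr (- w)\<close>, on the ray \<open>S\<close>, and the Taylor polynomial at \<open>x\<close>.\<close>
    define f where "f i z = (-1) ^ i * pochhammer w i * z powr (- w - of_nat i)" for i :: nat and z
    define S where "S = {z. Re z \<ge> real x} \<inter> \<real>"
    define B where "B = norm (pochhammer w N) * real x powr (- (Re w + real N))"
    define \<phi> where "\<phi> = (\<lambda>y. of_nat (x + y) powr (- w))"
    define T where "T = (\<lambda>y::nat. \<Sum>i\<le>M. f i (of_nat x) / fact i * of_nat y ^ i)"
    have B: "B \<ge> 0"
      by (simp add: B_def)
    have "eulerian_difference n T =
        (\<Sum>i\<le>M. f i (of_nat x) / fact i * eulerian_difference n (\<lambda>y. of_nat y ^ i))"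
      unfolding T_def eulerian_difference_sum eulerian_difference_cmult ..
    also have "\<dots> = 0"
      by (simp add: M vanish)
    finally have T: "eulerian_difference n T = 0" .
    have taylor: "norm (\<phi> y - T y) \<le> B * real (4 * n + 4) ^ N" if y: "y \<le> 4 * n + 3" for y
    proof -
      have "norm (f 0 (of_nat (x + y)) -
          (\<Sum>i\<le>M. f i (of_nat x) * (of_nat (x + y) - of_nat x) ^ i / fact i))
          \<le> B * norm (of_nat (x + y) - of_nat x :: complex) ^ Suc M / fact M"
      proof (rule complex_Taylor [of S])
        show "convex S"
          unfolding S_def by (intro convex_Int convex_halfspace_Re_ge convex_Reals)
      next
        fix i z assume z: "z \<in> S"
        then have "z \<notin> \<real>\<^sub>\<le>\<^sub>0"
          using x by (auto simp: S_def complex_nonpos_Reals_iff)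
        then have "((\<lambda>z. z powr (- w - of_nat i)) has_field_derivative
            (- w - of_nat i) * z powr (- w - of_nat i - 1)) (at z within S)"
          by (rule has_field_derivative_at_within [OF has_field_derivative_powr])
        from DERIV_cmult [OF this, of "(-1) ^ i * pochhammer w i"]
        show "(f i has_field_derivative f (Suc i) z) (at z within S)"
          unfolding f_def [abs_def] by (simp add: pochhammer_Suc algebra_simps)
      next
        fix z assume z: "z \<in> S"
        then have zR: "z \<in> \<real>" "Re z \<ge> real x"
          by (auto simp: S_def)
        have "norm (f (Suc M) z) = norm (pochhammer w N) * Re z powr Re (- w - of_nat N)"
          using zR x by (simp add: f_def M norm_mult norm_power norm_powr_real_powr)
        also have "Re (- w - of_nat N) = - (Re w + real N)"
          by simp
        also have "norm (pochhammer w N) * Re z powr (- (Re w + real N)) \<le> B"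
          unfolding B_def using zR x w by (intro mult_left_mono powr_mono2') auto
        finally show "norm (f (Suc M) z) \<le> B" .
      qed (auto simp: S_def)
      also have "f 0 (of_nat (x + y)) = \<phi> y"
        by (simp add: f_def \<phi>_def)
      also have "(\<Sum>i\<le>M. f i (of_nat x) * (of_nat (x + y) - of_nat x) ^ i / fact i) = T y"
        by (simp add: T_def)
      also have "B * norm (of_nat (x + y) - of_nat x :: complex) ^ Suc M / fact M \<le> B * real y ^ N"
        using B divide_left_mono [of 1 "fact M" "B * real y ^ N"] by (simp add: M fact_ge_1)
      also have "\<dots> \<le> B * real (4 * n + 4) ^ N"
        using B y by (intro mult_left_mono power_mono) auto
      finally show ?thesis .
    qed
    have "norm (eulerian_difference n \<phi>) = norm (eulerian_difference n (\<lambda>y. \<phi> y - T y))"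
      by (simp add: eulerian_difference_diff T)
    also have "\<dots> \<le> (\<Sum>j\<le>n. norm (eulerian_weight n j) * (2 * (B * real (4 * n + 4) ^ N)))"
      unfolding eulerian_difference_def
    proof (rule sum_norm_le)
      fix j assume j: "j \<in> {..n}"
      have "norm ((\<phi> (4 * (n - j) + 1) - T (4 * (n - j) + 1)) - (\<phi> (4 * j + 3) - T (4 * j + 3)))
          \<le> B * real (4 * n + 4) ^ N + B * real (4 * n + 4) ^ N"
        using j by (intro order.trans [OF norm_triangle_ineq4 add_mono [OF taylor taylor]]) auto
      then show "norm (eulerian_weight n j * ((\<phi> (4 * (n - j) + 1) - T (4 * (n - j) + 1)) - (\<phi> (4 * j + 3) - T (4 * j + 3))))
          \<le> norm (eulerian_weight n j) * (2 * (B * real (4 * n + 4) ^ N))"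
        unfolding norm_mult by (intro mult_left_mono) auto
    qed
    also have "\<dots> = C * norm (pochhammer w N) * real x powr (- (Re w + real N))"
      unfolding C_def B_def sum_distrib_right [symmetric] by (simp only: mult_ac)
    finally show "norm (eulerian_difference n (\<lambda>y. of_nat (x + y) powr (- w)))
         \<le> C * norm (pochhammer w N) * real x powr (- (Re w + real N))"
      unfolding \<phi>_def .
  qed
qed

text \<open>
  The argument is shifted by \<open>n\<close>: the sum over \<open>k\<close> will be \<open>\<beta>(w - n)\<close>.  The point of interest
  is \<open>w = 0\<close>.
\<close>

definition beta_term :: "nat \<Rightarrow> nat \<Rightarrow> complex \<Rightarrow> complex" where
  "beta_term n k w = of_nat ((n + k) choose n) *
     eulerian_difference n (\<lambda>y. of_nat (4 * k + y) powr (- w))"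

definition beta_term_deriv :: "nat \<Rightarrow> nat \<Rightarrow> complex \<Rightarrow> complex" where
  "beta_term_deriv n k w = of_nat ((n + k) choose n) *
     eulerian_difference n (\<lambda>y. - (Ln (of_nat (4 * k + y)) * of_nat (4 * k + y) powr (- w)))"

lemma has_field_derivative_beta_term:
  "(beta_term n k has_field_derivative beta_term_deriv n k w) (at w)"
proof -
  have *: "((\<lambda>w. of_nat c powr (- w)) has_field_derivative - (Ln (of_nat c) * of_nat c powr (- w))) (at w)"
    if "c > 0" for c :: nat
  proof -
    have "complex_of_nat c \<noteq> 0" using that by simp
    from has_field_derivative_powr_right [OF this] DERIV_minus [OF DERIV_ident]
    have "((\<lambda>w. of_nat c powr (- w)) has_field_derivative Ln (of_nat c) * of_nat c powr (- w) * (- 1)) (at w)"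
      by (rule DERIV_chain2)
    then show ?thesis by simp
  qed
  show ?thesis
    unfolding beta_term_def [abs_def] beta_term_deriv_def eulerian_difference_def
    by (intro DERIV_cmult DERIV_sum DERIV_diff *) auto
qed

lemma norm_pochhammer_le: "norm (pochhammer w N) \<le> (norm w + real N) ^ N"
  for w :: complex
proof -
  have "norm (pochhammer w N) = (\<Prod>i\<in>{0..<N}. norm (w + of_nat i))"
    by (simp add: pochhammer_prod prod_norm)
  also have "\<dots> \<le> (\<Prod>i\<in>{0..<N}. norm w + real N)"
  proof (rule prod_mono, safe)
    fix i assume "i \<in> {0..<N}"
    then show "norm (w + of_nat i) \<le> norm w + real N"
      using norm_triangle_ineq [of w "of_nat i"] by simp
  qed auto
  finally show ?thesis by simp
qed

lemma real_binomial_le_power: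
  assumes "k > 0"
  shows "real ((n + k) choose n) \<le> real (Suc n) ^ n * real k powr real n"
proof -
  have "(n + k) choose n \<le> (n + k) ^ n"
    by (rule binomial_le_pow) simp
  also have "\<dots> \<le> (Suc n * k) ^ n"
    using assms by (intro power_mono) auto
  finally have "real ((n + k) choose n) \<le> real ((Suc n * k) ^ n)"
    by (simp only: of_nat_le_iff)
  then show ?thesis
    using assms by (simp only: of_nat_power of_nat_mult power_mult_distrib powr_realpow of_nat_0_less_iff)
qed

text \<open>
  The decay \<open>k powr (- Re w - N)\<close> of the difference functional beats the growth \<open>k powr n\<close> of the
  binomial coefficient as soon as \<open>Re w > n + 1 - N\<close>.
\<close>

lemma beta_term_locally_dominated:
  assumes N: "N > 0" and vanish: "\<And>p. p < N \<Longrightarrow> eulerian_difference n (\<lambda>y. of_nat y ^ p) = 0"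
    and w0: "Re w0 > real n + 1 - real N"
  obtains d h where "d > 0" "summable h" "\<And>k. h k \<ge> 0"
    "\<And>k w. k > 0 \<Longrightarrow> w \<in> ball w0 d \<Longrightarrow> norm (beta_term n k w) \<le> h k"
proof -
  from eulerian_difference_powr_bound [OF N vanish] obtain C where C: "C \<ge> 0"
    "\<And>x w. x > 0 \<Longrightarrow> Re w + real N \<ge> 0 \<Longrightarrow>
       norm (eulerian_difference n (\<lambda>y. of_nat (x + y) powr (- w)))
         \<le> C * norm (pochhammer w N) * real x powr (- (Re w + real N))"
    by blast
  \<comment> \<open>Half the distance of \<open>w0\<close> to the boundary of the half plane.\<close>
  define d where "d = (Re w0 + real N - real n - 1) / 2"
  have d: "d > 0" using w0 by (simp add: d_def)
  define e where "e = Re w0 - d + real N"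
  have e: "e = real n + 1 + d"
    by (simp add: e_def d_def field_simps)
  define K where "K = real (Suc n) ^ n * (C * (norm w0 + d + real N) ^ N)"
  have K: "K \<ge> 0"
    using C(1) d by (simp add: K_def)
  define h where "h k = K * real k powr (real n - e)" for k
  show ?thesis
  proof
    show "d > 0" by fact
    show "summable h"
      unfolding h_def using d by (intro summable_mult) (simp add: summable_real_powr_iff e)
    show "h k \<ge> 0" for k
      using K by (simp add: h_def)
    fix k :: nat and w assume k: "k > 0" and w: "w \<in> ball w0 d"
    have nw: "norm w \<le> norm w0 + d"
      using w norm_triangle_ineq2 [of w w0] by (simp add: dist_norm norm_minus_commute)
    have "\<bar>Re (w0 - w)\<bar> < d"
      using w abs_Re_le_cmod [of "w0 - w"] by (simp add: dist_norm)
    then have re: "Re w + real N \<ge> e"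
      by (simp add: e_def)
    have "real (4 * k) powr (- (Re w + real N)) \<le> real k powr (- (Re w + real N))"
      using k re e d by (intro powr_mono2') auto
    also have "\<dots> \<le> real k powr (- e)"
      using k re by (intro powr_mono) auto
    finally have powr: "real (4 * k) powr (- (Re w + real N)) \<le> real k powr (- e)" .
    have poch: "norm (pochhammer w N) \<le> (norm w0 + d + real N) ^ N"
      using nw by (intro order.trans [OF norm_pochhammer_le] power_mono) auto
    have "norm (eulerian_difference n (\<lambda>y. of_nat (4 * k + y) powr (- w)))
        \<le> C * norm (pochhammer w N) * real (4 * k) powr (- (Re w + real N))"
      using k re e d by (intro C(2)) auto
    also have "\<dots> \<le> C * (norm w0 + d + real N) ^ N * real k powr (- e)"
      using C(1) d by (intro mult_mono poch powr mult_left_mono) auto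
    finally have "norm (beta_term n k w) \<le>
        (real (Suc n) ^ n * real k powr real n) * (C * (norm w0 + d + real N) ^ N * real k powr (- e))"
      unfolding beta_term_def norm_mult norm_of_nat
      using k by (intro mult_mono real_binomial_le_power) auto
    also have "\<dots> = h k"
      unfolding h_def K_def by (simp add: powr_diff powr_minus field_simps)
    finally show "norm (beta_term n k w) \<le> h k" .
  qed
qed

text \<open>
  The Weierstrass test allows termwise differentiation; Cauchy's inequality on a disc moves the
  majorant from the terms to their derivatives and so yields absolute convergence of the
  differentiated series as well.
\<close>

lemma beta_term_series:
  assumes N: "N > 0" and vanish: "\<And>p. p < N \<Longrightarrow> eulerian_difference n (\<lambda>y. of_nat y ^ p) = 0"
    and w: "Re w > real n + 1 - real N"
  defines "g \<equiv> \<lambda>w. \<Sum>k. beta_term n k w"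
  shows "(\<lambda>k. beta_term n k w) sums g w" and "summable (\<lambda>k. norm (beta_term_deriv n k w))"
    and "(g has_field_derivative (\<Sum>k. beta_term_deriv n k w)) (at w)"
proof -
  define S where "S = {w. Re w > real n + 1 - real N}"
  have S: "open S" and wS: "w \<in> S"
    using w by (auto simp: S_def open_halfspace_Re_gt)
  have "\<exists>G G'. \<forall>w\<in>S. (\<lambda>k. beta_term n k w) sums G w \<and> (\<lambda>k. beta_term_deriv n k w) sums G' w \<and>
      (G has_field_derivative G' w) (at w)"
  proof (rule series_and_derivative_comparison_complex [OF S])
    show "(beta_term n k has_field_derivative beta_term_deriv n k w) (at w)" for k w
      by (rule has_field_derivative_beta_term)
    fix w0 assume "w0 \<in> S"
    then have "Re w0 > real n + 1 - real N" by (simp add: S_def)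
    from beta_term_locally_dominated [OF N vanish this] obtain d h where h: "d > 0" "summable h"
      "\<And>k. h k \<ge> 0" "\<And>k w. k > 0 \<Longrightarrow> w \<in> ball w0 d \<Longrightarrow> norm (beta_term n k w) \<le> h k"
      by blast
    have "\<forall>\<^sub>F k in sequentially. \<forall>w\<in>ball w0 d \<inter> S. norm (beta_term n k w) \<le> norm (complex_of_real (h k))"
      using eventually_gt_at_top [of 0] by eventually_elim (use h in auto)
    with h show "\<exists>d h. 0 < d \<and> summable h \<and> range h \<subseteq> \<real>\<^sub>\<ge>\<^sub>0 \<and>
        (\<forall>\<^sub>F k in sequentially. \<forall>w\<in>ball w0 d \<inter> S. norm (beta_term n k w) \<le> norm (h k :: complex))"
      by (intro exI [of _ d] exI [of _ "\<lambda>k. complex_of_real (h k)"])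
         (auto simp: summable_complex_of_real)
  qed
  then obtain G G' where G: "\<And>w. w \<in> S \<Longrightarrow> (\<lambda>k. beta_term n k w) sums G w"
    "\<And>w. w \<in> S \<Longrightarrow> (\<lambda>k. beta_term_deriv n k w) sums G' w"
    "\<And>w. w \<in> S \<Longrightarrow> (G has_field_derivative G' w) (at w)"
    by blast
  have gG: "g w = G w" if "w \<in> S" for w
    unfolding g_def using G(1) [OF that] by (simp add: sums_iff)
  show "(\<lambda>k. beta_term n k w) sums g w"
    using G(1) [OF wS] gG [OF wS] by simp
  have "G' w = (\<Sum>k. beta_term_deriv n k w)"
    using G(2) [OF wS] by (simp add: sums_iff)
  then show "(g has_field_derivative (\<Sum>k. beta_term_deriv n k w)) (at w)"
    using has_field_derivative_transform_within_open [OF G(3) [OF wS] S wS] gG by force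
  from beta_term_locally_dominated [OF N vanish w] obtain d h where h: "d > 0" "summable h"
    "\<And>k. h k \<ge> 0" "\<And>k z. k > 0 \<Longrightarrow> z \<in> ball w d \<Longrightarrow> norm (beta_term n k z) \<le> h k"
    by blast
  show "summable (\<lambda>k. norm (beta_term_deriv n k w))"
  proof (rule summable_comparison_test_ev)
    show "summable (\<lambda>k. h k / (d / 2))"
      using h(2) by (rule summable_divide)
    show "\<forall>\<^sub>F k in sequentially. norm (norm (beta_term_deriv n k w)) \<le> h k / (d / 2)"
      using eventually_gt_at_top [of 0]
    proof eventually_elim
      case (elim k)
      have hol: "beta_term n k holomorphic_on A" for A
        by (rule holomorphic_on_subset [of _ UNIV])
           (auto intro!: has_field_derivative_beta_term simp: holomorphic_on_open)
      have "norm ((deriv ^^ 1) (beta_term n k) w) \<le> fact 1 * h k / (d / 2) ^ 1"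
      proof (rule Cauchy_inequality)
        show "beta_term n k holomorphic_on ball w (d / 2)" "continuous_on (cball w (d / 2)) (beta_term n k)"
          by (auto intro: hol holomorphic_on_imp_continuous_on)
        show "norm (beta_term n k z) \<le> h k" if "norm (w - z) = d / 2" for z
          using that h(1) elim by (intro h(4)) (auto simp: dist_norm)
      qed (use h(1) in auto)
      moreover have "deriv (beta_term n k) w = beta_term_deriv n k w"
        by (rule DERIV_imp_deriv [OF has_field_derivative_beta_term])
      ultimately show ?case by simp
    qed
  qed
qed

section \<open>Resummation in the domain of absolute convergence\<close>

text \<open>
  For \<open>m < i\<close> the binomial coefficient on the right has an upper index below \<open>n\<close> and vanishes,
  so both series have the same terms up to leading zeros.
\<close>

lemma binomial_sums_shift:
  fixes g :: "nat \<Rightarrow> complex"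
  assumes "i \<le> n"
  shows "(\<lambda>k. of_nat ((n + k) choose n) * g (k + i)) sums l \<longleftrightarrow>
         (\<lambda>m. of_nat ((m + (n - i)) choose n) * g m) sums l"
proof -
  define f where "f m = of_nat ((m + (n - i)) choose n) * g m" for m
  have "f m = 0" if "m < i" for m
    using that assms by (simp add: f_def binomial_eq_0)
  moreover have "(\<lambda>k. of_nat ((n + k) choose n) * g (k + i)) = (\<lambda>k. f (k + i))"
    using assms by (intro ext) (simp add: f_def add_ac)
  ultimately show ?thesis
    using sums_zero_iff_shift [of i f l] by (simp add: f_def)
qed

lemma summable_binomial_powr:
  fixes w :: complex
  assumes w: "Re w \<ge> real n + 2"
  shows "summable (\<lambda>k. of_nat ((n + k) choose n) * of_nat (4 * (k + i) + c) powr (- w))"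
proof (rule summable_comparison_test_ev)
  show "summable (\<lambda>k. real (Suc n) ^ n * real k powr (- 2))"
    by (intro summable_mult) (simp add: summable_real_powr_iff)
  show "\<forall>\<^sub>F k in sequentially. norm (of_nat ((n + k) choose n) * of_nat (4 * (k + i) + c) powr (- w))
      \<le> real (Suc n) ^ n * real k powr (- 2)"
    using eventually_gt_at_top [of 0]
  proof eventually_elim
    case (elim k)
    have "norm (complex_of_nat (4 * (k + i) + c) powr (- w)) = real (4 * (k + i) + c) powr (- Re w)"
      using norm_powr_real_powr [of "of_nat (4 * (k + i) + c)" "- w"] by simp
    also have "\<dots> \<le> real k powr (- Re w)"
      using elim w by (intro powr_mono2') auto
    also have "\<dots> \<le> real k powr (- (real n + 2))"
      using elim w by (intro powr_mono) auto
    finally have "norm (of_nat ((n + k) choose n) * complex_of_nat (4 * (k + i) + c) powr (- w))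
        \<le> (real (Suc n) ^ n * real k powr real n) * real k powr (- (real n + 2))"
      unfolding norm_mult norm_of_nat using elim by (intro mult_mono real_binomial_le_power) auto
    also have "\<dots> = real (Suc n) ^ n * (real k powr (real n + - (real n + 2)))"
      by (simp only: powr_add mult.assoc)
    finally show ?case by simp
  qed
qed

lemma beta_term_0: "beta_term 0 m s = of_nat (4 * m + 1) powr (- s) - of_nat (4 * m + 3) powr (- s)"
  by (simp add: beta_term_def eulerian_difference_def add.commute)

text \<open>
  Each of the \<open>2 (n + 1)\<close> series obtained by splitting the difference functional converges
  absolutely here.  Shifting them so that equal bases are aligned, the total coefficients of
  \<open>(4m + 1) powr (- w)\<close> and \<open>(4m + 3) powr (- w)\<close> are given by the Worpitzky identities.
  The resulting series is the Dirichlet series of \<open>\<beta>\<close> at \<open>w - n\<close>, with terms grouped in pairs.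
\<close>

lemma beta_term_sums_imp:
  assumes w: "Re w \<ge> real n + 2" and l: "(\<lambda>k. beta_term n k w) sums l"
  shows "(\<lambda>m. beta_term 0 m (w - of_nat n)) sums l"
proof -
  define b where "b = (\<lambda>k. of_nat ((n + k) choose n) :: complex)"
  define g where "g c m = complex_of_nat (4 * m + c) powr (- w)" for c m :: nat
  define L where "L c i = (\<Sum>k. b k * g c (k + i))" for c i
  have L: "(\<lambda>k. b k * g c (k + i)) sums L c i" for c i
    unfolding L_def b_def g_def using w by (intro summable_sums summable_binomial_powr)
  have "(\<lambda>k. \<Sum>j\<le>n. eulerian_weight n j * (b k * g 1 (k + (n - j)) - b k * g 3 (k + j)))
      sums (\<Sum>j\<le>n. eulerian_weight n j * (L 1 (n - j) - L 3 j))"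
    by (intro sums_sum sums_mult sums_diff L)
  also have "(\<lambda>k. \<Sum>j\<le>n. eulerian_weight n j * (b k * g 1 (k + (n - j)) - b k * g 3 (k + j))) =
      (\<lambda>k. beta_term n k w)"
    unfolding beta_term_def eulerian_difference_def sum_distrib_left
    by (intro ext sum.cong) (simp_all add: b_def g_def algebra_simps)
  finally have lL: "l = (\<Sum>j\<le>n. eulerian_weight n j * (L 1 (n - j) - L 3 j))"
    using l by (rule sums_unique2 [symmetric])
  have L1: "(\<lambda>m. ((of_nat m + of_nat j) gchoose n) * g 1 m) sums L 1 (n - j)" if "j \<le> n" for j
    using L [of 1 "n - j"] binomial_sums_shift [of "n - j" n "g 1"] that
    by (simp only: b_def binomial_gbinomial of_nat_add diff_le_self diff_diff_cancel)
  have L3: "(\<lambda>m. ((of_nat m + of_nat (n - j)) gchoose n) * g 3 m) sums L 3 j" if "j \<le> n" for j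
    using L [of 3 j] binomial_sums_shift [of j n "g 3"] that
    by (simp only: b_def binomial_gbinomial of_nat_add)
  have "(\<lambda>m. \<Sum>j\<le>n. eulerian_weight n j *
        (((of_nat m + of_nat j) gchoose n) * g 1 m - ((of_nat m + of_nat (n - j)) gchoose n) * g 3 m)) sums l"
    unfolding lL by (intro sums_sum sums_mult sums_diff L1 L3) auto
  also have "(\<lambda>m. \<Sum>j\<le>n. eulerian_weight n j *
        (((of_nat m + of_nat j) gchoose n) * g 1 m - ((of_nat m + of_nat (n - j)) gchoose n) * g 3 m)) =
      (\<lambda>m. (\<Sum>j\<le>n. eulerian_weight n j * ((of_nat m + of_nat j) gchoose n)) * g 1 m -
           (\<Sum>j\<le>n. eulerian_weight n j * ((of_nat m + of_nat (n - j)) gchoose n)) * g 3 m)"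
    by (simp only: right_diff_distrib sum_subtractf sum_distrib_right mult.assoc)
  also have "\<dots> = (\<lambda>m. beta_term 0 m (w - of_nat n))"
  proof
    fix m
    have *: "(4 * of_nat m + of_nat c) ^ n * g c m = of_nat (4 * m + c) powr (- (w - of_nat n))"
      if "c > 0" for c
    proof -
      have "- (w - of_nat n) = of_nat n + - w" by simp
      moreover have "complex_of_nat (4 * m + c) \<noteq> 0"
        using that by (simp only: of_nat_eq_0_iff)
      ultimately show ?thesis
        unfolding g_def by (simp only: powr_add powr_nat') simp
    qed
    show "(\<Sum>j\<le>n. eulerian_weight n j * ((of_nat m + of_nat j) gchoose n)) * g 1 m -
           (\<Sum>j\<le>n. eulerian_weight n j * ((of_nat m + of_nat (n - j)) gchoose n)) * g 3 m =
        beta_term 0 m (w - of_nat n)"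
      unfolding sum_eulerian_weight_gchoose sum_eulerian_weight_gchoose_reflected beta_term_0
      using * [of 1] * [of 3] by simp
  qed
  finally show ?thesis .
qed

section \<open>Analytic continuation of the Dirichlet beta function\<close>

definition beta_series :: "nat \<Rightarrow> complex \<Rightarrow> complex" where
  "beta_series n s = (\<Sum>k. beta_term n k (s + of_nat n))"

lemma eulerian_difference_power_eq_0_odd:
  assumes "odd n" "p < n + 2"
  shows "eulerian_difference n (\<lambda>y. of_nat y ^ p) = 0"
proof (cases "p \<le> n")
  case False
  then have "p = n + 1" using assms by simp
  then show ?thesis using eulerian_difference_power_Suc_eq_0 [OF assms(1)] by simp
qed (rule eulerian_difference_power_eq_0)

lemma beta_term_sums_beta_series:
  assumes "Re s > - real n"
  shows "(\<lambda>k. beta_term n k (s + of_nat n)) sums beta_series n s"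
  unfolding beta_series_def
  by (rule beta_term_series(1) [where N = "n + 1"])
     (use assms in \<open>auto simp: eulerian_difference_power_eq_0\<close>)

lemma holomorphic_on_beta_series: "beta_series n holomorphic_on {s. Re s > - real n}"
proof -
  have "(beta_series n has_field_derivative (\<Sum>k. beta_term_deriv n k (s + of_nat n))) (at s)"
    if "Re s > - real n" for s
  proof -
    have "((\<lambda>w. \<Sum>k. beta_term n k w) has_field_derivative
        (\<Sum>k. beta_term_deriv n k (s + of_nat n))) (at (s + of_nat n))"
      by (rule beta_term_series(3) [where N = "n + 1"])
         (use that in \<open>auto simp: eulerian_difference_power_eq_0\<close>)
    then show ?thesis
      unfolding DERIV_shift beta_series_def [abs_def] .
  qed
  then show ?thesis
    by (auto simp: holomorphic_on_open open_halfspace_Re_gt)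
qed

lemma
  assumes "odd n" "Re s > - real n - 1"
  shows has_field_derivative_beta_series_odd:
      "(beta_series n has_field_derivative (\<Sum>k. beta_term_deriv n k (s + of_nat n))) (at s)"
    and summable_norm_beta_term_deriv_odd:
      "summable (\<lambda>k. norm (beta_term_deriv n k (s + of_nat n)))"
proof -
  have s: "Re (s + of_nat n) > real n + 1 - real (n + 2)"
    using assms(2) by simp
  have "((\<lambda>w. \<Sum>k. beta_term n k w) has_field_derivative
      (\<Sum>k. beta_term_deriv n k (s + of_nat n))) (at (s + of_nat n))"
    by (rule beta_term_series(3) [OF _ _ s]) (use assms(1) in \<open>auto intro: eulerian_difference_power_eq_0_odd\<close>)
  then show "(beta_series n has_field_derivative (\<Sum>k. beta_term_deriv n k (s + of_nat n))) (at s)"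
    unfolding DERIV_shift beta_series_def [abs_def] .
  show "summable (\<lambda>k. norm (beta_term_deriv n k (s + of_nat n)))"
    by (rule beta_term_series(2) [OF _ _ s]) (use assms(1) in \<open>auto intro: eulerian_difference_power_eq_0_odd\<close>)
qed

lemma beta_series_eq_0:
  assumes "Re s > 0"
  shows "beta_series n s = beta_series 0 s"
proof (rule analytic_continuation_open [of "{s. Re s > 2}" "{s. Re s > 0}" "beta_series n" "beta_series 0"])
  show "open {s. Re s > 2}" "open {s. Re s > 0}"
    by (rule open_halfspace_Re_gt)+
  have "3 \<in> {s. Re s > 2}" by simp
  then show "{s. Re s > 2} \<noteq> {}" by blast
  show "beta_series n holomorphic_on {s. Re s > 0}" "beta_series 0 holomorphic_on {s. Re s > 0}"
    by (rule holomorphic_on_subset [OF holomorphic_on_beta_series], force)+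
  fix z assume "z \<in> {s. Re s > 2}"
  then have z: "Re z > 2" by simp
  have "(\<lambda>m. beta_term 0 m (z + of_nat n - of_nat n)) sums beta_series n z"
    by (rule beta_term_sums_imp [OF _ beta_term_sums_beta_series]) (use z in auto)
  moreover have "(\<lambda>m. beta_term 0 m z) sums beta_series 0 z"
    using beta_term_sums_beta_series [of 0 z] z by simp
  ultimately show "beta_series n z = beta_series 0 z"
    by (simp add: sums_unique2)
qed (use assms in auto)

lemma beta_series_eq:
  assumes "m \<le> n" "Re s > - real m"
  shows "beta_series m s = beta_series n s"
proof (rule analytic_continuation_open [of "{s. Re s > 0}" "{s. Re s > - real m}" "beta_series m" "beta_series n"])
  show "open {s. Re s > 0}" "open {s. Re s > - real m}"
    by (rule open_halfspace_Re_gt)+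
  have "1 \<in> {s. Re s > 0}" by simp
  then show "{s. Re s > 0} \<noteq> {}" by blast
  show "beta_series n holomorphic_on {s. Re s > - real m}" "beta_series m holomorphic_on {s. Re s > - real m}"
    by (rule holomorphic_on_subset [OF holomorphic_on_beta_series]; use assms(1) in force)+
qed (use assms in \<open>auto simp: beta_series_eq_0 [of _ m] beta_series_eq_0 [of _ n]\<close>)

text \<open>
  The series of \<open>\<beta>\<close> converges only conditionally for \<open>0 < Re s \<le> 1\<close>, whereas the terms
  \<open>beta_term 0 k s\<close> are its consecutive pairs; ungrouping is legitimate because the terms tend to
  zero.
\<close>

lemma sums_of_grouped_pairs:
  fixes a :: "nat \<Rightarrow> 'a :: real_normed_vector"
  assumes pairs: "(\<lambda>k. a (2 * k) + a (2 * k + 1)) sums l" and "a \<longlonglongrightarrow> 0"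
  shows "a sums l"
proof -
  have double: "(\<Sum>i<2 * m. a i) = (\<Sum>k<m. a (2 * k) + a (2 * k + 1))" for m
    by (induction m) simp_all
  have "(\<lambda>m. \<Sum>i<2 * (m div 2). a i) \<longlonglongrightarrow> l"
    unfolding double
  proof (rule filterlim_compose [of _ _ sequentially])
    show "(\<lambda>m. \<Sum>k<m. a (2 * k) + a (2 * k + 1)) \<longlonglongrightarrow> l"
      using pairs by (simp add: sums_def)
    show "filterlim (\<lambda>m::nat. m div 2) at_top sequentially"
      unfolding filterlim_at_top
    proof
      fix c :: nat
      show "\<forall>\<^sub>F m in sequentially. c \<le> m div 2"
        using eventually_ge_at_top [of "2 * c"] by eventually_elim auto
    qed
  qed
  moreover have "(\<lambda>m. if odd m then a (m - 1) else 0) \<longlonglongrightarrow> 0"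
  proof (rule Lim_null_comparison)
    show "\<forall>\<^sub>F m in sequentially. norm (if odd m then a (m - 1) else 0) \<le> norm (a (m - 1))"
      by simp
    have "(\<lambda>m. a (m - 1)) \<longlonglongrightarrow> 0"
      using assms(2) filterlim_minus_const_nat_at_top by (rule filterlim_compose)
    then show "(\<lambda>m. norm (a (m - 1))) \<longlonglongrightarrow> 0"
      by (rule tendsto_norm_zero)
  qed
  ultimately have "(\<lambda>m. (\<Sum>i<2 * (m div 2). a i) + (if odd m then a (m - 1) else 0)) \<longlonglongrightarrow> l + 0"
    by (rule tendsto_add)
  moreover have "(\<Sum>i<2 * (m div 2). a i) + (if odd m then a (m - 1) else 0) = (\<Sum>i<m. a i)" for m
    by (cases "even m") (auto elim!: evenE oddE)
  ultimately show ?thesis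
    by (simp add: sums_def)
qed

lemma alternating_series_sums_beta_series:
  assumes s: "Re s > 0"
  shows "(\<lambda>m. (-1) ^ m * of_nat (2 * m + 1) powr (- s)) sums beta_series 0 s"
proof (rule sums_of_grouped_pairs)
  have "(\<lambda>k. beta_term 0 k s) sums beta_series 0 s"
    using beta_term_sums_beta_series [of 0 s] s by simp
  then show "(\<lambda>k. (-1) ^ (2 * k) * of_nat (2 * (2 * k) + 1) powr (- s) +
      (-1) ^ (2 * k + 1) * of_nat (2 * (2 * k + 1) + 1) powr (- s)) sums beta_series 0 s"
    by (simp add: beta_term_0 algebra_simps)
  have "(\<lambda>m. real (2 * m + 1) powr (- Re s)) \<longlonglongrightarrow> 0"
    using s by (intro tendsto_neg_powr filterlim_compose [OF filterlim_real_sequentially] filterlim_subseq)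
      (auto simp: strict_mono_def)
  moreover have "norm ((-1) ^ m * of_nat (2 * m + 1) powr (- s)) = real (2 * m + 1) powr (- Re s)" for m
    using norm_powr_real_powr [of "of_nat (2 * m + 1)" "- s"] by (simp add: norm_mult norm_power)
  ultimately show "(\<lambda>m. (-1) ^ m * of_nat (2 * m + 1) powr (- s)) \<longlonglongrightarrow> 0"
    by (intro tendsto_norm_zero_cancel [of "\<lambda>m. (-1) ^ m * of_nat (2 * m + 1) powr (- s)"]) (simp only:)
qed

lemma dirichlet_beta_eqI:
  assumes f: "f holomorphic_on UNIV"
    and sums: "\<And>s. Re s > 0 \<Longrightarrow> (\<lambda>m. (-1) ^ m * of_nat (2 * m + 1) powr (- s)) sums f s"
  shows "dirichlet_beta = f"
  unfolding dirichlet_beta_def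
proof (rule the_equality)
  fix g assume g: "g holomorphic_on UNIV \<and>
     (\<forall>s. Re s > 0 \<longrightarrow> (\<lambda>m. (-1) ^ m * of_nat (2 * m + 1) powr (- s)) sums g s)"
  have "1 \<in> {s. Re s > 0}" by simp
  then have "{s. Re s > 0} \<noteq> {}" by blast
  then have "g s = f s" for s
    by (intro analytic_continuation_open [of "{s. Re s > 0}" UNIV g f s])
       (use f g sums in \<open>auto simp: open_halfspace_Re_gt intro: sums_unique2\<close>)
  then show "g = f" by blast
qed (use f sums in blast)

text \<open>
  The functions \<open>beta_series n\<close> agree on the overlaps of their half planes, so they glue to an
  entire function, which must be \<open>\<beta>\<close>.
\<close>

lemma dirichlet_beta_eq_beta_series:
  assumes "Re s > - real n"
  shows "dirichlet_beta s = beta_series n s"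
proof -
  \<comment> \<open>Any index \<open>n > - Re s\<close> would give the same value.\<close>
  define f where "f s = beta_series (nat \<lceil>- Re s\<rceil> + 1) s" for s
  have f: "f s = beta_series n s" if "Re s > - real n" for s n
  proof -
    have "Re s > - real (nat \<lceil>- Re s\<rceil> + 1)"
      by linarith
    with that show ?thesis
      unfolding f_def
      using beta_series_eq [of n "nat \<lceil>- Re s\<rceil> + 1" s] beta_series_eq [of "nat \<lceil>- Re s\<rceil> + 1" n s]
      by (cases "n \<le> nat \<lceil>- Re s\<rceil> + 1") auto
  qed
  have "dirichlet_beta = f"
  proof (rule dirichlet_beta_eqI)
    have "f field_differentiable at s" for s
    proof -
      define n where "n = nat \<lceil>- Re s\<rceil> + 1"
      have s: "s \<in> {s. Re s > - real n}"
        unfolding n_def mem_Collect_eq by linarith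
      have "beta_series n field_differentiable at s"
        using holomorphic_on_beta_series [of n] s
        by (auto simp: holomorphic_on_open open_halfspace_Re_gt field_differentiable_def)
      then show ?thesis
        unfolding field_differentiable_def
        using has_field_derivative_transform_within_open [OF _ open_halfspace_Re_gt s] f
        by (metis mem_Collect_eq)
    qed
    then show "f holomorphic_on UNIV"
      by (simp add: holomorphic_on_def)
  next
    fix s assume "Re s > 0"
    then show "(\<lambda>m. (-1) ^ m * of_nat (2 * m + 1) powr (- s)) sums f s"
      using alternating_series_sums_beta_series [of s] f [of 0 s] by simp
  qed
  then show ?thesis
    using f [OF assms] by simp
qed

text \<open>
  For odd \<open>n\<close> the half plane of convergence is larger by one unit and contains the point \<open>- n\<close>
  in its interior, at which the derivative is to be taken.
\<close>

lemma dirichlet_beta_eq_beta_series_odd: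
  assumes "odd n" "Re s > - real n - 1"
  shows "dirichlet_beta s = beta_series n s"
proof -
  have "beta_series (n + 1) s = beta_series n s"
  proof (rule analytic_continuation_open [of "{s. Re s > 0}" "{s. Re s > - real n - 1}" "beta_series (n + 1)" "beta_series n"])
    show "open {s. Re s > 0}" "open {s. Re s > - real n - 1}"
      by (rule open_halfspace_Re_gt)+
    have "1 \<in> {s. Re s > 0}" by simp
    then show "{s. Re s > 0} \<noteq> {}" by blast
    show "beta_series (n + 1) holomorphic_on {s. Re s > - real n - 1}"
      by (rule holomorphic_on_subset [OF holomorphic_on_beta_series]) auto
    show "beta_series n holomorphic_on {s. Re s > - real n - 1}"
      using has_field_derivative_beta_series_odd [OF assms(1)]
      by (auto simp: holomorphic_on_open open_halfspace_Re_gt)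
  qed (use assms in \<open>auto simp: beta_series_eq_0 [of _ n] beta_series_eq_0 [of _ "Suc n"]\<close>)
  moreover have "dirichlet_beta s = beta_series (n + 1) s"
    using assms by (intro dirichlet_beta_eq_beta_series) simp
  ultimately show ?thesis by simp
qed

section \<open>The infinite product\<close>

lemma ln_powi: "x > 0 \<Longrightarrow> ln (x powi i) = of_int i * ln x"
  for x :: real
  by (simp add: powr_real_of_int' [symmetric] ln_powr)

lemma beta_prod_factor_pos: "beta_prod_factor n k > 0"
  unfolding beta_prod_factor_def by (intro zero_less_power prod_pos divide_pos_pos zero_less_power_int) auto

lemma ln_beta_prod_factor: "complex_of_real (ln (beta_prod_factor n k)) = beta_term_deriv n k 0"
proof -
  have "ln (beta_prod_factor n k) = real ((n + k) choose n) *
      (\<Sum>j\<le>n. of_int (gen_eulerian n (int j)) * (ln (real (4 * k + 4 * j + 3)) - ln (real (4 * k + 4 * (n - j) + 1))))"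
    unfolding beta_prod_factor_def
    by (simp add: ln_realpow ln_prod ln_div ln_powi prod_pos atLeast0AtMost right_diff_distrib
         del: of_nat_add of_nat_mult)
  also have "complex_of_real \<dots> =
      of_nat ((n + k) choose n) * eulerian_difference n (\<lambda>y. - complex_of_real (ln (real (4 * k + y))))"
    unfolding eulerian_difference_def by (simp add: add.assoc del: of_nat_add of_nat_mult)
  also have "eulerian_difference n (\<lambda>y. - complex_of_real (ln (real (4 * k + y)))) =
      eulerian_difference n (\<lambda>y. - (Ln (of_nat (4 * k + y)) * of_nat (4 * k + y) powr (- 0)))"
  proof (rule eulerian_difference_cong)
    fix y :: nat assume "y > 0"
    then have "4 * k + y > 0" by simp
    then show "- complex_of_real (ln (real (4 * k + y))) =
        - (Ln (of_nat (4 * k + y)) * of_nat (4 * k + y) powr (- 0))"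
      by (simp del: of_nat_add of_nat_mult)
  qed
  also have "of_nat ((n + k) choose n) * \<dots> = beta_term_deriv n k 0"
    unfolding beta_term_deriv_def ..
  finally show ?thesis .
qed

theorem theorem6p2:
  fixes n :: nat
  assumes "n \<ge> 1" and "odd n"
  shows "summable (\<lambda>k. \<bar>ln (beta_prod_factor n k)\<bar>) \<and>
         exp (deriv dirichlet_beta (- of_nat n)) = complex_of_real (\<Prod>k. beta_prod_factor n k)"
proof
  define a where "a = (\<lambda>k. ln (beta_prod_factor n k))"
  have a: "beta_term_deriv n k 0 = complex_of_real (a k)" for k
    by (simp add: a_def ln_beta_prod_factor)
  show abs_summable: "summable (\<lambda>k. \<bar>ln (beta_prod_factor n k)\<bar>)"
    using summable_norm_beta_term_deriv_odd [OF assms(2), of "- of_nat n"] by (simp add: a a_def)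
  then have sum: "summable a"
    unfolding a_def by (rule summable_rabs_cancel)
  define S where "S = {s. Re s > - real n - 1}"
  have "(beta_series n has_field_derivative (\<Sum>k. beta_term_deriv n k 0)) (at (- of_nat n))"
    using has_field_derivative_beta_series_odd [OF assms(2), of "- of_nat n"] by simp
  then have "(dirichlet_beta has_field_derivative (\<Sum>k. beta_term_deriv n k 0)) (at (- of_nat n))"
    by (rule has_field_derivative_transform_within_open [of _ _ _ S])
       (auto simp: S_def open_halfspace_Re_gt dirichlet_beta_eq_beta_series_odd [OF assms(2)])
  then have "deriv dirichlet_beta (- of_nat n) = (\<Sum>k. complex_of_real (a k))"
    unfolding a by (rule DERIV_imp_deriv)
  also have "\<dots> = complex_of_real (suminf a)"
    using sum by (rule suminf_of_real [symmetric])
  finally have "exp (deriv dirichlet_beta (- of_nat n)) = complex_of_real (exp (suminf a))"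
    by (simp add: exp_of_real)
  also have "exp (suminf a) = (\<Prod>k. exp (a k))"
    using sum by (rule prodinf_exp [symmetric])
  also have "(\<lambda>k. exp (a k)) = beta_prod_factor n"
    by (simp add: a_def beta_prod_factor_pos fun_eq_iff)
  finally show "exp (deriv dirichlet_beta (- of_nat n)) = complex_of_real (\<Prod>k. beta_prod_factor n k)" .
qed

end
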